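(* Let $q$ be a prime power, $F=\mathbb F_q$, and let $d>0$ and $n>1$ be integers with $n\mid(q-1)$. Then there exists a generalized weighing matrix $$A\in GW\left(\frac{q^{d+1}-1}{q-1},\,q^d;\,n\right),$$ with rows indexed by $X=\mathbb P^d(F)$ and columns indexed by $Y=\mathbb P^d(F)$, such that $|A|$ is the characteristic matrix of the $GL_{d+1}(F)$-orbit of all $(x,y)\in X\times Y$ such that $x$ is not contained in the hyperplane dual to $y$. Moreover, every automorphism in the image of $GL_{d+1}(F)\to\mathrm{PermAut}(|A|)$ lifts to an automorphism of $A$.
   Context: $\mu_n\subset\mathbb C^\times$ is the group of $n$-th roots of unity, $\mu_n^+=\{0\}\cup\mu_n$. $GW(N,w;n)$ is the set of $N\times N$ matrices $W$ with entries in $\mu_n^+$ and $WW^*=wI_N$ ($*$ is conjugate-transpose). $|A|$ is the entrywise absolute value. $\mathbb P^d(F)$ is the set of lines through the origin in $F^{d+1}$. The hyperplane dual to $y=[w]\in\mathbb P^d(F)$ is $\{v\in F^{d+1}:\sum_i v_iw_i=0\}$. $G=GL_{d+1}(F)$ acts on $X$ by $[v]\mapsto[gv]$ and on $Y$ by $[w]\mapsto[(g^{-1})^Tw]$. $\mathrm{PermAut}(|A|)$ is the group of pairs $(P,Q)$ of permutation matrices (indexed by $X$ and by $Y$) with $P|A|Q^*=|A|$; $GL_{d+1}(F)$ maps to it by the permutation matrices of its actions on $X$ and $Y$. An automorphism of $A$ is a pair $(P,Q)$ of monomial matrices with nonzero entries in $\mu_n$ such that $PAQ^*=A$; it lifts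 $(|P|,|Q|)\in\mathrm{PermAut}(|A|)$. *)

theory Defs
  imports "HOL-Analysis.Analysis" "HOL-Number_Theory.Prime_Powers"
begin

subsection \<open>Generalized weighing matrices\<close>

definition roots_of_unity :: "nat \<Rightarrow> complex set"
  where "roots_of_unity n = {z. z ^ n = 1}"

definition roots_of_unity0 :: "nat \<Rightarrow> complex set"
  where "roots_of_unity0 n = insert 0 (roots_of_unity n)"

definition ctranspose :: "complex ^ 'c ^ 'r \<Rightarrow> complex ^ 'r ^ 'c"
  where "ctranspose A = (\<chi> j i. cnj (A $ i $ j))"

definition abs_matrix :: "complex ^ 'c ^ 'r \<Rightarrow> complex ^ 'c ^ 'r"
  where "abs_matrix A = (\<chi> i j. of_real (norm (A $ i $ j)))"

text \<open>
  Rows and columns are indexed by two possibly different finite types, both of which have to have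
  exactly \<open>N\<close> elements. The term \<open>mat (of_nat w)\<close> is the scalar matrix \<open>w I\<close>.
\<close>

definition GW :: "nat \<Rightarrow> nat \<Rightarrow> nat \<Rightarrow> (complex ^ 'c::finite ^ 'r::finite) set"
  where "GW N w n = {W. CARD('r) = N \<and> CARD('c) = N \<and>
    (\<forall>i j. W $ i $ j \<in> roots_of_unity0 n) \<and> W ** ctranspose W = mat (of_nat w)}"

subsection \<open>Monomial and permutation matrices, automorphisms\<close>

text \<open>The matrix acting on column vectors by \<open>axis i 1 \<mapsto> axis (f i) 1\<close>.\<close>

definition matrix_of_map :: "('i \<Rightarrow> 'i) \<Rightarrow> complex ^ 'i ^ 'i"
  where "matrix_of_map f = (\<chi> j i. if j = f i then 1 else 0)"

definition permutation_matrix :: "complex ^ 'i ^ 'i \<Rightarrow> bool"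
  where "permutation_matrix P \<longleftrightarrow> (\<exists>f. bij f \<and> P = matrix_of_map f)"

definition monomial_matrix :: "complex ^ 'i ^ 'i \<Rightarrow> bool"
  where "monomial_matrix M \<longleftrightarrow>
    (\<forall>i. \<exists>!j. M $ i $ j \<noteq> 0) \<and> (\<forall>j. \<exists>!i. M $ i $ j \<noteq> 0)"

definition PermAut ::
    "complex ^ 'c::finite ^ 'r::finite \<Rightarrow> ((complex ^ 'r ^ 'r) \<times> (complex ^ 'c ^ 'c)) set"
  where "PermAut B = {(P, Q). permutation_matrix P \<and> permutation_matrix Q \<and>
    P ** B ** ctranspose Q = B}"

definition Aut ::
    "nat \<Rightarrow> complex ^ 'c::finite ^ 'r::finite \<Rightarrow> ((complex ^ 'r ^ 'r) \<times> (complex ^ 'c ^ 'c)) set"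
  where "Aut n A = {(P, Q). monomial_matrix P \<and> monomial_matrix Q \<and>
    (\<forall>i j. P $ i $ j \<noteq> 0 \<longrightarrow> P $ i $ j \<in> roots_of_unity n) \<and>
    (\<forall>i j. Q $ i $ j \<noteq> 0 \<longrightarrow> Q $ i $ j \<in> roots_of_unity n) \<and>
    P ** A ** ctranspose Q = A}"

definition lifts_to_Aut ::
    "nat \<Rightarrow> complex ^ 'c::finite ^ 'r::finite \<Rightarrow>
    (complex ^ 'r ^ 'r) \<times> (complex ^ 'c ^ 'c) \<Rightarrow> bool"
  where "lifts_to_Aut n A PQ \<longleftrightarrow>
    (\<exists>(P, Q) \<in> Aut n A. (abs_matrix P, abs_matrix Q) = PQ)"

subsection \<open>Projective space and the action of the general linear group\<close>

text \<open>
  The lines through the origin in \<open>'a ^ 'm\<close>; this is projective space of dimension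
  \<open>CARD('m) - 1\<close>. Being a type, it can index the rows and columns of a matrix.
\<close>

typedef (overloaded) ('a::field, 'm::finite) proj =
    "{L :: ('a ^ 'm) set. vec.subspace L \<and> vec.dim L = 1}"
  morphisms line_of proj_of_line
proof -
  have "vec.dim (vec.span {axis undefined 1 :: 'a ^ 'm}) = 1"
    by (simp add: vec.dim_span_eq_card_independent axis_eq_0_iff)
  then show ?thesis
    using vec.subspace_span by blast
qed

instance proj :: ("{field, finite}", finite) finite
proof
  have "finite (range (line_of :: ('a, 'b) proj \<Rightarrow> _))"
    by simp
  then show "finite (UNIV :: ('a, 'b) proj set)"
    by (rule finite_imageD) (simp add: line_of_inject inj_on_def)
qed

definition proj_point :: "'a::field ^ 'm::finite \<Rightarrow> ('a, 'm) proj"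
  where "proj_point v = proj_of_line (vec.span {v})"

text \<open>
  Quantifying over all vectors of \<open>y\<close> avoids choosing a representative;
  see \<open>dual_hyperplane_proj_point\<close>.
\<close>

definition dual_hyperplane :: "('a::field, 'm::finite) proj \<Rightarrow> ('a ^ 'm) set"
  where "dual_hyperplane y = {v. \<forall>w \<in> line_of y. (\<Sum>i\<in>UNIV. v $ i * w $ i) = 0}"

definition GL :: "('a::field ^ 'm::finite ^ 'm) set"
  where "GL = {g. invertible g}"

text \<open>The two actions are only meaningful for \<open>g \<in> GL\<close>.\<close>

definition act_X :: "'a::field ^ 'm::finite ^ 'm \<Rightarrow> ('a, 'm) proj \<Rightarrow> ('a, 'm) proj"
  where "act_X g x = proj_of_line ((\<lambda>v. g *v v) ` line_of x)"

definition act_Y :: "'a::field ^ 'm::finite ^ 'm \<Rightarrow> ('a, 'm) proj \<Rightarrow> ('a, 'm) proj"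
  where "act_Y g y = proj_of_line ((\<lambda>w. transpose (matrix_inv g) *v w) ` line_of y)"

definition GL_orbit :: "('a::field, 'm::finite) proj \<times> ('a, 'm) proj \<Rightarrow>
    (('a, 'm) proj \<times> ('a, 'm) proj) set"
  where "GL_orbit = (\<lambda>(x, y). {(act_X g x, act_Y g y) | g. g \<in> GL})"

definition GL_perm :: "'a::{field, finite} ^ 'm::finite ^ 'm \<Rightarrow>
    (complex ^ ('a, 'm) proj ^ ('a, 'm) proj) \<times> (complex ^ ('a, 'm) proj ^ ('a, 'm) proj)"
  where "GL_perm g = (matrix_of_map (act_X g), matrix_of_map (act_Y g))"

definition nonincident :: "(('a::field, 'm::finite) proj \<times> ('a, 'm) proj) set"
  where "nonincident = {(x, y). \<not> line_of x \<subseteq> dual_hyperplane y}"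

definition char_matrix :: "('r \<times> 'c) set \<Rightarrow> complex ^ 'c ^ 'r"
  where "char_matrix S = (\<chi> i j. if (i, j) \<in> S then 1 else 0)"

lemma line_of_proj_point:
  assumes "v \<noteq> 0"
  shows "line_of (proj_point v) = vec.span {v}"
proof -
  have "vec.dim (vec.span {v}) = 1"
    using assms by (simp add: vec.dim_span_eq_card_independent)
  then show ?thesis
    unfolding proj_point_def by (intro proj_of_line_inverse) (simp add: vec.subspace_span)
qed

lemma proj_point_cases:
  obtains v where "v \<noteq> 0" "x = proj_point v"
proof -
  have L: "vec.subspace (line_of x)" "vec.dim (line_of x) = 1"
    using line_of[of x] by auto
  obtain B where B: "B \<subseteq> line_of x" "vec.independent B" "line_of x \<subseteq> vec.span B"
      "card B = vec.dim (line_of x)"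
    using vec.basis_exists by blast
  then obtain v where v: "B = {v}"
    using L card_1_singletonE by metis
  have "vec.span {v} = line_of x"
    using B L v vec.span_minimal by blast
  moreover have "v \<noteq> 0"
    using B v vec.dependent_zero by blast
  ultimately show thesis
    using that[of v] by (simp add: proj_point_def line_of_inverse)
qed

lemma dual_hyperplane_proj_point:
  assumes "w \<noteq> 0"
  shows "dual_hyperplane (proj_point w) = {v. (\<Sum>i\<in>UNIV. v $ i * w $ i) = 0}"
proof -
  have *: "(\<Sum>i\<in>UNIV. v $ i * (c * w $ i)) = c * (\<Sum>i\<in>UNIV. v $ i * w $ i)" for v :: "'a ^ 'b" and c
    by (simp add: sum_distrib_left ac_simps)
  have "w \<in> line_of (proj_point w)"
    using assms by (simp add: line_of_proj_point vec.span_base)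
  then show ?thesis
    using assms by (auto simp: dual_hyperplane_def line_of_proj_point vec.span_singleton *)
qed

lemma mult_line_proj_point:
  assumes "v \<noteq> 0"
  shows "(\<lambda>u. g *v u) ` line_of (proj_point v) = vec.span {g *v v}"
  using assms vec.linear_span_image[of "(*v) g" "{v}"] by (simp add: line_of_proj_point)

lemma act_X_proj_point:
  "v \<noteq> 0 \<Longrightarrow> act_X g (proj_point v) = proj_point (g *v v)"
  unfolding act_X_def by (subst mult_line_proj_point) (assumption, simp only: proj_point_def)

lemma act_Y_proj_point:
  "w \<noteq> 0 \<Longrightarrow> act_Y g (proj_point w) = proj_point (transpose (matrix_inv g) *v w)"
  unfolding act_Y_def by (subst mult_line_proj_point) (assumption, simp only: proj_point_def)

end

theory Submission
  imports Defs "HOL-Algebra.Algebraic_Closure_Type"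
begin

text \<open>
  Write \<open>\<langle>v, w\<rangle>\<close> for \<open>\<Sum>\<^sub>i v\<^sub>i w\<^sub>i\<close>. As \<open>F\<^sup>*\<close> is cyclic of order divisible by \<open>n\<close>, there is a
  nontrivial multiplicative character \<open>\<psi>\<close> of \<open>F\<close> with values in \<open>\<mu>\<^sub>n\<^sup>+\<close>, where \<open>\<psi>(0) = 0\<close>
  (\<open>ex_nontrivial_character\<close>). Choose a vector in every point; the matrix with the entries
  \<open>\<psi>\<langle>v\<^sub>x, w\<^sub>y\<rangle>\<close> has the required properties.

  The entry at \<open>(x, y)\<close> vanishes exactly if \<open>x\<close> lies in the hyperplane dual to \<open>y\<close>, so the entrywise
  absolute value is the characteristic matrix of nonincidence.

  The product of \<open>\<psi>\<langle>v, w\<rangle>\<close> and the conjugate of \<open>\<psi>\<langle>v', w\<rangle>\<close> is unchanged when \<open>w\<close> is scaled, so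
  the inner product of two rows is \<open>1/(q - 1)\<close> times its sum over all vectors \<open>w\<close>. For equal rows
  the sum counts the vectors not orthogonal to \<open>v\<close>, of which there are \<open>q\<^sup>d (q - 1)\<close>
  (\<open>card_nonorthogonal\<close>). For independent \<open>v\<close> and \<open>v'\<close> and a scalar \<open>c\<close> with \<open>\<psi>(c) \<noteq> 1\<close>, a linear
  substitution that multiplies \<open>\<langle>v, w\<rangle>\<close> by \<open>c\<close> and keeps \<open>\<langle>v', w\<rangle>\<close> shows that the sum equals
  \<open>\<psi>(c)\<close> times itself, hence is \<open>0\<close> (\<open>character_sum_eq_0\<close>).

  An invertible \<open>g\<close> satisfies \<open>\<langle>g v, g\<^sup>-\<^sup>T w\<rangle> = \<langle>v, w\<rangle>\<close>. It maps the chosen vectors to scalar multiples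
  of chosen vectors, and since \<open>\<psi>\<close> is multiplicative, correcting the two permutation matrices by the
  values of \<open>\<psi>\<close> at these scalars gives an automorphism (\<open>weighing_matrix_lifts_GL\<close>).

  Nonincidence is a single orbit because the pairs \<open>(v, w)\<close> with \<open>\<langle>v, w\<rangle> = 1\<close> are permuted
  transitively; matrices of the form \<open>I + a b\<^sup>T\<close> suffice to see this
  (\<open>GL_transitive_on_dual_pairs\<close>).
\<close>

(* The dollar sign is to denote vector components only, not coefficients of power series. *)
unbundle no Formal_Power_Series.fps_syntax

section \<open>The pairing of vectors\<close>

definition pairing :: "'a::comm_semiring_1 ^ 'm::finite \<Rightarrow> 'a ^ 'm \<Rightarrow> 'a"
  where "pairing v w = (\<Sum>i\<in>UNIV. v $ i * w $ i)"

lemma pairing_zero [simp]: "pairing 0 w = 0" "pairing v 0 = 0"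
  by (simp_all add: pairing_def)

lemma pairing_add: "pairing (v + v') w = pairing v w + pairing v' w"
    "pairing v (w + w') = pairing v w + pairing v w'"
  by (simp_all add: pairing_def algebra_simps sum.distrib)

lemma pairing_diff:
  fixes v v' w w' :: "'a::comm_ring_1 ^ 'm::finite"
  shows "pairing (v - v') w = pairing v w - pairing v' w"
    "pairing v (w - w') = pairing v w - pairing v w'"
  by (simp_all add: pairing_def algebra_simps sum_subtractf)

lemma pairing_scale: "pairing (c *s v) w = c * pairing v w" "pairing v (c *s w) = c * pairing v w"
  by (simp_all add: pairing_def algebra_simps sum_distrib_left)

lemma pairing_commute: "pairing v w = pairing w v"
  by (simp add: pairing_def mult.commute)

lemma pairing_axis [simp]: "pairing v (axis i c) = v $ i * c"
proof -
  have "pairing v (axis i c) = (\<Sum>j\<in>UNIV. if j = i then v $ j * c else 0)"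
    unfolding pairing_def axis_def by (intro sum.cong) auto
  then show ?thesis by simp
qed

lemma pairing_matrix_vector_mult: "pairing (g *v v) w = pairing v (transpose g *v w)"
  unfolding pairing_def matrix_vector_mult_def transpose_def
  by (simp add: sum_distrib_left sum_distrib_right, subst sum.swap) (simp add: ac_simps)

lemma ex_nonzero_component:
  assumes "v \<noteq> 0"
  obtains i where "v $ i \<noteq> 0"
  using assms by (auto simp: vec_eq_iff)

lemma ex_pairing_eq_1:
  fixes v :: "'a::field ^ 'm::finite"
  assumes "v \<noteq> 0"
  obtains u where "pairing v u = 1"
proof -
  obtain i where "v $ i \<noteq> 0" using assms by (rule ex_nonzero_component)
  then have "pairing v (axis i (1 / v $ i)) = 1" by simp
  then show thesis by (rule that)
qed

text \<open>If every minor \<open>v\<^sub>i v'\<^sub>j - v\<^sub>j v'\<^sub>i\<close> vanishes, then \<open>v'\<close> is a multiple of \<open>v\<close>; a nonzero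
  minor gives \<open>u\<close> by Cramer's rule.\<close>

lemma ex_pairing_eq_1_0:
  fixes v v' :: "'a::field ^ 'm::finite"
  assumes "v \<noteq> 0" and nonprop: "\<And>c. v' \<noteq> c *s v"
  obtains u where "pairing v u = 1" "pairing v' u = 0"
proof -
  obtain i where i: "v $ i \<noteq> 0" using assms(1) by (rule ex_nonzero_component)
  have "v' \<noteq> (v' $ i / v $ i) *s v" by (rule nonprop)
  then obtain j where "v' $ j \<noteq> v' $ i / v $ i * v $ j"
    by (auto simp: vec_eq_iff)
  with i have D: "v $ i * v' $ j - v $ j * v' $ i \<noteq> 0" (is "?D \<noteq> 0")
    by (auto simp: field_simps)
  let ?u = "axis i (v' $ j / ?D) - axis j (v' $ i / ?D)"
  have "pairing v ?u = 1"
    using D by (simp add: pairing_diff diff_divide_distrib[symmetric])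
  moreover have "pairing v' ?u = 0"
    by (simp add: pairing_diff mult.commute)
  ultimately show thesis by (rule that)
qed

section \<open>Representatives of projective points\<close>

definition rep :: "('a::field, 'm::finite) proj \<Rightarrow> 'a ^ 'm"
  where "rep x = (SOME v. v \<noteq> 0 \<and> x = proj_point v)"

lemma rep_nonzero [simp]: "rep x \<noteq> 0"
  and proj_point_rep [simp]: "proj_point (rep x) = x"
proof -
  have "\<exists>v. v \<noteq> 0 \<and> x = proj_point v"
    using proj_point_cases by metis
  then have "rep x \<noteq> 0 \<and> x = proj_point (rep x)"
    unfolding rep_def by (rule someI_ex)
  then show "rep x \<noteq> 0" "proj_point (rep x) = x" by simp_all
qed

lemma proj_point_scale:
  fixes v :: "'a::field ^ 'm::finite"
  assumes "c \<noteq> 0"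
  shows "proj_point (c *s v) = proj_point v"
proof -
  have "range (\<lambda>k. k *s (c *s v)) = range (\<lambda>k. k *s v)"
  proof (intro equalityI subsetI)
    fix x assume "x \<in> range (\<lambda>k. k *s v)"
    then obtain k where "x = k *s v" by blast
    then have "x = (k / c) *s (c *s v)" using assms by simp
    then show "x \<in> range (\<lambda>k. k *s (c *s v))" by blast
  qed auto
  then show ?thesis
    by (simp add: proj_point_def vec.span_singleton)
qed

lemma proj_point_eq_iff:
  fixes v w :: "'a::field ^ 'm::finite"
  assumes "v \<noteq> 0" "w \<noteq> 0"
  shows "proj_point v = proj_point w \<longleftrightarrow> (\<exists>c. c \<noteq> 0 \<and> w = c *s v)"
proof
  assume "proj_point v = proj_point w"
  then have "vec.span {v} = vec.span {w}"
    using assms line_of_proj_point by metis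
  then have "w \<in> vec.span {v}" by (simp add: vec.span_base)
  then show "\<exists>c. c \<noteq> 0 \<and> w = c *s v"
    using assms(2) by (auto simp: vec.span_singleton)
qed (auto simp: proj_point_scale)

lemma rep_proj_point:
  fixes v :: "'a::field ^ 'm::finite"
  assumes "v \<noteq> 0"
  obtains c where "c \<noteq> 0" "rep (proj_point v) = c *s v"
  using proj_point_eq_iff[OF assms rep_nonzero, of "proj_point v"] by auto

lemma nonincident_iff_pairing:
  assumes "v \<noteq> 0" "w \<noteq> 0"
  shows "(proj_point v, proj_point w) \<in> nonincident \<longleftrightarrow> pairing v w \<noteq> 0"
proof -
  have "line_of (proj_point v) \<subseteq> dual_hyperplane (proj_point w) \<longleftrightarrow>
      (\<forall>c. pairing (c *s v) w = 0)"
    using assms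
    by (simp add: line_of_proj_point dual_hyperplane_proj_point vec.span_singleton
        image_subset_iff flip: pairing_def)
  also have "\<dots> \<longleftrightarrow> pairing v w = 0"
    by (metis mult_zero_right pairing_scale(1) vector_smult_lid)
  finally show ?thesis by (simp add: nonincident_def)
qed

text \<open>Each projective point has \<open>q - 1\<close> nonzero representatives, so a sum over points may be
  replaced by a sum over vectors, where linear substitutions are available.\<close>

lemma sum_vectors_eq_sum_points:
  fixes f :: "'f::{field, finite} ^ 'm::finite \<Rightarrow> 'b::comm_semiring_1"
  assumes zero: "f 0 = 0" and scale: "\<And>c w. c \<noteq> 0 \<Longrightarrow> f (c *s w) = f w"
  shows "(\<Sum>w\<in>UNIV. f w) = of_nat (CARD('f) - 1) * (\<Sum>y\<in>UNIV. f (rep y))"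
proof -
  have fibre: "(\<Sum>w | w \<in> - {0} \<and> proj_point w = y. f w) = of_nat (CARD('f) - 1) * f (rep y)"
    for y
  proof -
    have eq: "{w. w \<in> - {0} \<and> proj_point w = y} = (\<lambda>c. c *s rep y) ` (- {0})"
      using proj_point_eq_iff[OF rep_nonzero, of _ y] by (auto simp: proj_point_scale)
    have "inj_on (\<lambda>c. c *s rep y) (- {0})"
      by (auto simp: inj_on_def)
    then have "(\<Sum>w | w \<in> - {0} \<and> proj_point w = y. f w) = (\<Sum>c\<in>- {0::'f}. f (c *s rep y))"
      unfolding eq by (simp add: sum.reindex)
    also have "\<dots> = (\<Sum>c\<in>- {0::'f}. f (rep y))"
      by (intro sum.cong) (auto simp: scale)
    finally show ?thesis by (simp add: Compl_eq_Diff_UNIV card_Diff_subset)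
  qed
  have "(\<Sum>w\<in>UNIV. f w) = (\<Sum>w\<in>- {0}. f w)"
    by (rule sum.mono_neutral_right) (auto simp: zero)
  also have "\<dots> = (\<Sum>y\<in>UNIV. \<Sum>w | w \<in> - {0} \<and> proj_point w = y. f w)"
    by (rule sum.group[symmetric]) auto
  finally show ?thesis
    by (simp only: fibre sum_distrib_left)
qed

lemma card_proj:
  "(CARD('f::{field, finite}) - 1) * CARD(('f, 'm::finite) proj) = CARD('f) ^ CARD('m) - 1"
proof -
  have "(\<Sum>w::'f ^ 'm\<in>UNIV. if w = 0 then 0 else 1) = CARD('f) ^ CARD('m) - (1::nat)"
    by (simp add: sum.If_cases Compl_eq_Diff_UNIV card_Diff_subset)
  then show ?thesis
    using sum_vectors_eq_sum_points[of "\<lambda>w::'f ^ 'm. if w = 0 then 0 else 1 :: nat"] by simp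
qed

section \<open>The action of the general linear group\<close>

lemma matrix_inv_mult:
  assumes "invertible (g :: 'a::field ^ 'm::finite ^ 'm)"
  shows "g ** matrix_inv g = mat 1" "matrix_inv g ** g = mat 1"
proof -
  have "g ** matrix_inv g = mat 1 \<and> matrix_inv g ** g = mat 1"
    using assms unfolding invertible_def matrix_inv_def by (rule someI_ex)
  then show "g ** matrix_inv g = mat 1" "matrix_inv g ** g = mat 1" by simp_all
qed

definition contragredient :: "'a::field ^ 'm::finite ^ 'm \<Rightarrow> 'a ^ 'm ^ 'm"
  where "contragredient g = transpose (matrix_inv g)"

lemma contragredient_mult_transpose:
  assumes "invertible (g :: 'a::field ^ 'm::finite ^ 'm)"
  shows "contragredient g ** transpose g = mat 1" "transpose g ** contragredient g = mat 1"
  using matrix_inv_mult[OF assms]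
  by (metis contragredient_def matrix_transpose_mul transpose_mat)+

lemma pairing_contragredient:
  assumes "invertible (g :: 'a::field ^ 'm::finite ^ 'm)"
  shows "pairing (g *v v) (contragredient g *v w) = pairing v w"
  by (simp add: pairing_matrix_vector_mult matrix_vector_mul_assoc
      contragredient_mult_transpose[OF assms])

text \<open>Evaluates the contragredient action without inverting a matrix.\<close>

lemma contragredient_eqI:
  assumes "invertible (g :: 'a::field ^ 'm::finite ^ 'm)" "transpose g *v w' = w"
  shows "contragredient g *v w = w'"
proof -
  have "contragredient g *v w = (contragredient g ** transpose g) *v w'"
    using assms(2) by (simp only: flip: matrix_vector_mul_assoc)
  then show ?thesis
    by (simp add: contragredient_mult_transpose[OF assms(1)])
qed

lemma invertible_vector_mult_nonzero:
  assumes "invertible (g :: 'a::field ^ 'm::finite ^ 'm)" "v \<noteq> 0"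
  shows "g *v v \<noteq> 0"
  using assms
  by (metis matrix_inv_mult(2) matrix_vector_mul_assoc matrix_vector_mul_lid
      matrix_vector_mult_0_right)

lemma contragredient_vector_mult_nonzero:
  assumes "invertible (g :: 'a::field ^ 'm::finite ^ 'm)" "w \<noteq> 0"
  shows "contragredient g *v w \<noteq> 0"
  using assms
  by (metis contragredient_mult_transpose(2) matrix_vector_mul_assoc matrix_vector_mul_lid
      matrix_vector_mult_0_right)

text \<open>Injectivity is enough because there are finitely many points. Both actions of \<open>g\<close> are maps of
  this kind.\<close>

lemma bij_proj_map:
  fixes h :: "'f::{field, finite} ^ 'm::finite ^ 'm"
  assumes act: "\<And>v. v \<noteq> 0 \<Longrightarrow> f (proj_point v) = proj_point (h *v v)" and "k ** h = mat 1"
  shows "bij f"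
proof -
  have k: "k *v (h *v v) = v" for v
    using assms(2) by (simp add: matrix_vector_mul_assoc)
  then have nz: "h *v v \<noteq> 0" if "v \<noteq> 0" for v
    using that by (metis matrix_vector_mult_0_right)
  have "inj f"
  proof (rule injI)
    fix x y assume "f x = f y"
    then have "proj_point (h *v rep x) = proj_point (h *v rep y)"
      using act[of "rep x"] act[of "rep y"] by simp
    then obtain c where c: "c \<noteq> 0" "h *v rep y = c *s (h *v rep x)"
      using nz by (auto simp: proj_point_eq_iff)
    then have "rep y = c *s rep x"
      by (metis k vector_scalar_commute)
    then have "proj_point (rep x) = proj_point (rep y)"
      using c(1) by (simp add: proj_point_scale)
    then show "x = y" by simp
  qed
  then show ?thesis
    by (simp add: finite_UNIV_inj_surj bij_def)
qed

lemma bij_act_X: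
  assumes "invertible (g :: 'f::{field, finite} ^ 'm::finite ^ 'm)"
  shows "bij (act_X g)"
  using bij_proj_map[OF act_X_proj_point matrix_inv_mult(2)[OF assms]] .

lemma act_Y_contragredient:
  "w \<noteq> 0 \<Longrightarrow> act_Y g (proj_point w) = proj_point (contragredient g *v w)"
  by (simp add: act_Y_proj_point contragredient_def)

lemma bij_act_Y:
  assumes "invertible (g :: 'f::{field, finite} ^ 'm::finite ^ 'm)"
  shows "bij (act_Y g)"
  using bij_proj_map[OF act_Y_contragredient contragredient_mult_transpose(2)[OF assms]] .

lemma nonincident_act_iff:
  assumes g: "invertible (g :: 'a::field ^ 'm::finite ^ 'm)"
  shows "(act_X g x, act_Y g y) \<in> nonincident \<longleftrightarrow> (x, y) \<in> nonincident"
proof -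
  have "(proj_point (g *v rep x), proj_point (contragredient g *v rep y)) \<in> nonincident \<longleftrightarrow>
      (proj_point (rep x), proj_point (rep y)) \<in> nonincident"
    by (simp only: nonincident_iff_pairing pairing_contragredient[OF g] rep_nonzero
        invertible_vector_mult_nonzero[OF g] contragredient_vector_mult_nonzero[OF g]
        not_False_eq_True)
  then show ?thesis
    using act_X_proj_point[of "rep x" g] act_Y_contragredient[of "rep y" g] by simp
qed

section \<open>Transitivity on nonincident pairs\<close>

definition rank_one_update :: "'a::comm_ring_1 ^ 'm::finite \<Rightarrow> 'a ^ 'm \<Rightarrow> 'a ^ 'm ^ 'm"
  where "rank_one_update a b = mat 1 + (\<chi> i j. a $ i * b $ j)"

lemma rank_one_update_mult: "rank_one_update a b *v x = x + pairing b x *s a"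
proof -
  have "(\<chi> i j. a $ i * b $ j) *v x = pairing b x *s a"
    by (simp add: vec_eq_iff matrix_vector_mult_def pairing_def sum_distrib_left
        sum_distrib_right ac_simps)
  then show ?thesis
    by (simp add: rank_one_update_def matrix_vector_mult_add_rdistrib)
qed

lemma transpose_rank_one_update: "transpose (rank_one_update a b) = rank_one_update b a"
  by (simp add: rank_one_update_def transpose_def mat_def vec_eq_iff mult.commute)

text \<open>This is the Sherman--Morrison formula for the identity matrix.\<close>

lemma rank_one_update_inverse:
  fixes a b :: "'a::field ^ 'm::finite"
  assumes "1 + pairing b a \<noteq> 0"
  shows "rank_one_update (- (1 / (1 + pairing b a)) *s a) b ** rank_one_update a b = mat 1"
proof -
  have "rank_one_update (- (1 / (1 + pairing b a)) *s a) b *v (rank_one_update a b *v x) = x" for x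
  proof -
    define p t where "p = pairing b x" and "t = pairing b a"
    have "rank_one_update (- (1 / (1 + t)) *s a) b *v (rank_one_update a b *v x) =
        x + (p + (p + p * t) * (- (1 / (1 + t)))) *s a"
      by (simp only: rank_one_update_mult pairing_add pairing_scale p_def[symmetric] t_def[symmetric]
          vec.scale_scale vec.scale_left_distrib add.assoc)
    also have "p + (p + p * t) * (- (1 / (1 + t))) = 0"
      using assms by (simp add: t_def[symmetric] field_simps)
    finally show ?thesis by (simp add: t_def)
  qed
  then show ?thesis
    by (simp add: matrix_eq matrix_vector_mul_assoc)
qed

lemma invertible_rank_one_update:
  fixes a b :: "'a::field ^ 'm::finite"
  assumes "1 + pairing b a \<noteq> 0"
  shows "invertible (rank_one_update a b)"
  using rank_one_update_inverse[OF assms] by (auto simp: invertible_left_inverse)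

text \<open>A vector space is not the union of two hyperplanes: of vectors \<open>u\<close> and \<open>u'\<close> outside the first
  and the second one, one of \<open>u\<close>, \<open>u'\<close>, \<open>u + u'\<close> is outside both.\<close>

lemma ex_common_nonorthogonal:
  fixes v v' :: "'a::field ^ 'm::finite"
  assumes "v \<noteq> 0" "v' \<noteq> 0"
  obtains w where "pairing v w \<noteq> 0" "pairing v' w \<noteq> 0"
proof -
  obtain u where u: "pairing v u = 1" using assms(1) by (rule ex_pairing_eq_1)
  obtain u' where u': "pairing v' u' = 1" using assms(2) by (rule ex_pairing_eq_1)
  show thesis
  proof (cases "pairing v' u = 0 \<and> pairing v u' = 0")
    case True
    then have "pairing v (u + u') \<noteq> 0" "pairing v' (u + u') \<noteq> 0"
      using u u' by (simp_all add: pairing_add)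
    then show thesis by (rule that)
  next
    case False
    then show thesis using u u' that[of u] that[of u'] by auto
  qed
qed

text \<open>If \<open>\<langle>v, b\<rangle> = 1\<close>, then \<open>I + (v' - v) b\<^sup>T\<close> maps \<open>v\<close> to \<open>v'\<close>, and it is invertible as soon as
  \<open>1 + \<langle>b, v' - v\<rangle> = \<langle>v', b\<rangle>\<close> is nonzero.\<close>

lemma GL_transitive_on_nonzero:
  fixes v v' :: "'a::field ^ 'm::finite"
  assumes "v \<noteq> 0" "v' \<noteq> 0"
  obtains g where "invertible g" "g *v v = v'"
proof -
  obtain w where w: "pairing v w \<noteq> 0" "pairing v' w \<noteq> 0"
    using assms by (rule ex_common_nonorthogonal)
  let ?b = "(1 / pairing v w) *s w"
  have b: "pairing ?b v = 1" "pairing ?b v' \<noteq> 0"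
    using w by (simp_all add: pairing_scale pairing_commute[of w])
  have "invertible (rank_one_update (v' - v) ?b)"
    using b by (intro invertible_rank_one_update) (simp add: pairing_diff)
  moreover have "rank_one_update (v' - v) ?b *v v = v'"
    using b by (simp add: rank_one_update_mult)
  ultimately show thesis by (rule that)
qed

text \<open>After \<open>v\<close> has been moved to \<open>v'\<close>, the update \<open>I + v' (u - w')\<^sup>T\<close> fixes \<open>v'\<close>, because
  \<open>u\<close> and \<open>w'\<close> pair to \<open>1\<close> with it, and its contragredient moves \<open>u\<close> to \<open>w'\<close>.\<close>

lemma GL_transitive_on_dual_pairs:
  fixes v w v' w' :: "'a::field ^ 'm::finite"
  assumes vw: "pairing v w = 1" and vw': "pairing v' w' = 1"
  obtains g where "invertible g" "g *v v = v'" "contragredient g *v w = w'"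
proof -
  have "v \<noteq> 0" "v' \<noteq> 0" using assms by auto
  then obtain g where g: "invertible g" "g *v v = v'"
    by (rule GL_transitive_on_nonzero)
  define u where "u = contragredient g *v w"
  have u: "pairing v' u = 1"
    using pairing_contragredient[OF g(1), of v w] g(2) vw by (simp add: u_def)
  define h where "h = rank_one_update v' (u - w')"
  have h: "invertible h"
    unfolding h_def using u vw'
    by (intro invertible_rank_one_update) (simp add: pairing_diff pairing_commute[of _ v'])
  have hv: "h *v v' = v'"
    using u vw' by (simp add: h_def rank_one_update_mult pairing_diff pairing_commute[of _ v'])
  have hw: "transpose h *v w' = u"
    using vw' by (simp add: h_def transpose_rank_one_update rank_one_update_mult)
  have gu: "transpose g *v u = w"
    by (simp add: u_def matrix_vector_mul_assoc contragredient_mult_transpose[OF g(1)])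
  have inv: "invertible (h ** g)"
    using h g(1) by (rule invertible_mult)
  moreover have "(h ** g) *v v = v'"
    using g(2) hv by (simp flip: matrix_vector_mul_assoc)
  moreover have "contragredient (h ** g) *v w = w'"
    using hw gu by (intro contragredient_eqI[OF inv])
      (simp add: matrix_transpose_mul flip: matrix_vector_mul_assoc)
  ultimately show thesis by (rule that)
qed

lemma nonincident_is_GL_orbit:
  "(nonincident :: (('a::field, 'm::finite) proj \<times> ('a, 'm) proj) set) \<in> range GL_orbit"
proof -
  let ?e = "axis undefined 1 :: 'a ^ 'm"
  have e: "pairing ?e ?e = 1" "?e \<noteq> 0" by (simp_all add: axis_eq_0_iff)
  have "nonincident = GL_orbit (proj_point ?e, proj_point ?e)"
  proof (intro equalityI subsetI)
    fix p assume "p \<in> (nonincident :: (('a, 'm) proj \<times> ('a, 'm) proj) set)"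
    then obtain x y where p: "p = (x, y)" and xy: "(x, y) \<in> nonincident" by (cases p) auto
    (* Rescaling the vector of y makes the pairing 1. *)
    define c where "c = pairing (rep x) (rep y)"
    have c: "c \<noteq> 0"
      using xy nonincident_iff_pairing[of "rep x" "rep y"] by (simp add: c_def)
    define w where "w = (1 / c) *s rep y"
    have w: "w \<noteq> 0" "proj_point w = y"
    proof -
      show "w \<noteq> 0" using c by (simp add: w_def)
      then have "proj_point (rep y) = proj_point w"
        using c by (subst proj_point_eq_iff) (auto simp: w_def intro!: exI[of _ "1 / c"])
      then show "proj_point w = y" by simp
    qed
    have "pairing (rep x) w = 1"
      using c by (simp add: w_def pairing_scale c_def[symmetric])
    with e(1) obtain g where g: "invertible g" "g *v ?e = rep x" "contragredient g *v ?e = w"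
      by (rule GL_transitive_on_dual_pairs)
    have "act_X g (proj_point ?e) = x" "act_Y g (proj_point ?e) = y"
      using g w e(2) by (simp_all add: act_X_proj_point act_Y_contragredient)
    then show "p \<in> GL_orbit (proj_point ?e, proj_point ?e)"
      using g(1) p by (auto simp: GL_orbit_def GL_def)
  next
    fix p assume "p \<in> GL_orbit (proj_point ?e, proj_point ?e)"
    then show "p \<in> nonincident"
      using e by (auto simp: GL_orbit_def GL_def nonincident_act_iff nonincident_iff_pairing)
  qed
  then show ?thesis by blast
qed

section \<open>Multiplicative characters of a finite field\<close>

text \<open>A generator of the cyclic group \<open>F\<^sup>*\<close>, transferred from the ring whose carrier is the
  whole type.\<close>

lemma ex_generator_of_units:
  "\<exists>g :: 'f::{field, finite}. (\<forall>a. a \<noteq> 0 \<longrightarrow> (\<exists>k. a = g ^ k)) \<and>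
     (\<forall>k. g ^ k = 1 \<longleftrightarrow> CARD('f) - 1 dvd k)"
proof -
  define R where "R = (ring_of_type_algebra :: 'f ring)"
  interpret R: field R unfolding R_def by (rule field_from_type_algebra)
  define M where "M = Multiplicative_Group.mult_of R"
  interpret G: group M unfolding M_def by (rule R.field_mult_group)
  have carrier: "carrier M = - {0}"
    by (auto simp: M_def R_def ring_of_type_algebra_def)
  have pow: "a [^]\<^bsub>M\<^esub> k = a ^ k" for a and k :: nat
    by (induction k) (auto simp: nat_pow_def M_def Multiplicative_Group.mult_of_def R_def
        ring_of_type_algebra_def)
  have one: "\<one>\<^bsub>M\<^esub> = 1"
    by (simp add: M_def Multiplicative_Group.mult_of_def R_def ring_of_type_algebra_def)
  obtain g where g: "g \<in> carrier M"
      and gen: "carrier M = {g [^]\<^bsub>R\<^esub> i | i::nat. i \<in> UNIV}"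
    using R.finite_field_mult_group_has_gen by (auto simp: M_def)
  have gen': "carrier M = {g [^]\<^bsub>M\<^esub> i | i. i \<in> (UNIV :: nat set)}"
    using gen by (simp add: M_def Multiplicative_Group.nat_pow_mult_of)
  have "G.ord g \<noteq> 0"
    using G.ord_ge_1[OF _ g] by simp
  then have "generate M {g} = carrier M"
    using G.generate_pow_nat[OF g] gen' by auto
  then have "G.ord g = CARD('f) - 1"
    using G.generate_pow_card[OF g] by (simp add: carrier Compl_eq_Diff_UNIV card_Diff_subset)
  then have "\<forall>k. g ^ k = 1 \<longleftrightarrow> CARD('f) - 1 dvd k"
    using G.pow_eq_id[OF g] by (simp add: pow one)
  moreover have "\<forall>a. a \<noteq> 0 \<longrightarrow> (\<exists>k. a = g ^ k)"
    using gen' unfolding carrier pow by blast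
  ultimately show ?thesis by blast
qed

locale nontrivial_character =
  fixes \<psi> :: "'f::{field, finite} \<Rightarrow> complex" and n :: nat
  assumes order_pos: "n > 0"
    and char_zero [simp]: "\<psi> 0 = 0"
    and char_mult: "\<psi> (a * b) = \<psi> a * \<psi> b"
    and char_pow: "a \<noteq> 0 \<Longrightarrow> \<psi> a ^ n = 1"
    and nontrivial: "\<exists>c. c \<noteq> 0 \<and> \<psi> c \<noteq> 1"
begin

lemma norm_char: "a \<noteq> 0 \<Longrightarrow> norm (\<psi> a) = 1"
  using power_eq_1_iff[OF char_pow] order_pos by auto

lemma char_mult_cnj: "a \<noteq> 0 \<Longrightarrow> \<psi> a * cnj (\<psi> a) = 1"
  by (simp add: norm_char flip: complex_norm_square)

end

text \<open>Send \<open>g\<^sup>k\<close> to \<open>\<zeta>\<^sup>k\<close>, where \<open>g\<close> generates \<open>F\<^sup>*\<close> and \<open>\<zeta>\<close> is a primitive \<open>n\<close>-th root of unity. This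
  is well defined because the order \<open>q - 1\<close> of \<open>g\<close> is a multiple of \<open>n\<close>.\<close>

lemma ex_nontrivial_character:
  assumes "n > 1" "n dvd CARD('f::{field, finite}) - 1"
  shows "\<exists>\<psi> :: 'f \<Rightarrow> complex. nontrivial_character \<psi> n"
proof -
  obtain g :: 'f where gen: "\<And>a. a \<noteq> 0 \<Longrightarrow> \<exists>k. a = g ^ k"
      and ord: "\<And>k. g ^ k = 1 \<longleftrightarrow> CARD('f) - 1 dvd k"
    using ex_generator_of_units[where 'f = 'f] by blast
  have "g \<noteq> 0"
  proof
    assume "g = 0"
    moreover have "CARD('f) - 1 > 0"
      using card_mono[of UNIV "{0, 1 :: 'f}"] by simp
    ultimately show False
      using ord[of "CARD('f) - 1"] by (simp add: power_0_left)
  qed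
  define \<zeta> where "\<zeta> = cis (2 * pi / real n)"
  have zeta: "\<zeta> ^ n = 1"
    using assms(1) by (simp add: \<zeta>_def Complex.DeMoivre)
  have "\<zeta> \<noteq> 1"
  proof
    assume "\<zeta> = 1"
    have "cis (2 * pi * real 1 / real n) = cis (2 * pi * real 0 / real n)"
      using \<open>\<zeta> = 1\<close> by (simp add: \<zeta>_def)
    moreover have "inj_on (\<lambda>k. cis (2 * pi * real k / real n)) {..<n}"
      using Complex.bij_betw_roots_unity[of n] assms(1) by (auto simp: bij_betw_def)
    ultimately show False
      using inj_onD[of _ "{..<n}" 1 0] assms(1) by fastforce
  qed
  define dlog where "dlog a = (SOME k. a = g ^ k)" for a
  have dlog: "g ^ dlog a = a" if "a \<noteq> 0" for a
    using someI_ex[OF gen[OF that]] by (simp add: dlog_def)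
  have cong: "\<zeta> ^ k = \<zeta> ^ l" if "g ^ k = g ^ l" for k l
  proof -
    have *: "\<zeta> ^ k = \<zeta> ^ l" if "g ^ k = g ^ l" "k \<le> l" for k l
    proof -
      have "g ^ k * g ^ (l - k) = g ^ l"
        using that(2) by (simp only: power_add[symmetric] le_add_diff_inverse)
      then have "g ^ (l - k) = 1"
        using that(1) \<open>g \<noteq> 0\<close> by simp
      then have "n dvd l - k"
        using ord assms(2) dvd_trans by blast
      then have "\<zeta> ^ (l - k) = 1"
        using zeta by (auto simp: dvd_def power_mult)
      then have "\<zeta> ^ k = \<zeta> ^ k * \<zeta> ^ (l - k)" by simp
      then show ?thesis
        using that(2) by (simp only: power_add[symmetric] le_add_diff_inverse)
    qed
    show ?thesis
    proof (cases "k \<le> l")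
      case True
      with that show ?thesis by (rule *)
    next
      case False
      then show ?thesis using *[OF that[symmetric]] by simp
    qed
  qed
  define \<psi> where "\<psi> a = (if a = 0 then 0 else \<zeta> ^ dlog a)" for a
  have "nontrivial_character \<psi> n"
  proof
    show "n > 0" using assms(1) by simp
    show "\<psi> 0 = 0" by (simp add: \<psi>_def)
    show "\<psi> (a * b) = \<psi> a * \<psi> b" for a b
    proof (cases "a = 0 \<or> b = 0")
      case False
      then have "g ^ dlog (a * b) = g ^ (dlog a + dlog b)"
        by (simp add: dlog power_add)
      then have "\<zeta> ^ dlog (a * b) = \<zeta> ^ (dlog a + dlog b)"
        by (rule cong)
      with False show ?thesis by (simp add: \<psi>_def power_add)
    qed (auto simp: \<psi>_def)
    show "\<psi> a ^ n = 1" if "a \<noteq> 0" for a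
    proof -
      have "\<psi> a ^ n = (\<zeta> ^ n) ^ dlog a"
        using that by (simp add: \<psi>_def mult.commute flip: power_mult)
      then show ?thesis by (simp add: zeta)
    qed
    have "g ^ dlog g = g ^ 1"
      using dlog[OF \<open>g \<noteq> 0\<close>] by simp
    then have "\<zeta> ^ dlog g = \<zeta> ^ 1"
      by (rule cong)
    then have "\<psi> g = \<zeta>"
      using \<open>g \<noteq> 0\<close> by (simp add: \<psi>_def)
    then show "\<exists>c. c \<noteq> 0 \<and> \<psi> c \<noteq> 1"
      using \<open>g \<noteq> 0\<close> \<open>\<zeta> \<noteq> 1\<close> by auto
  qed
  then show ?thesis by blast
qed

section \<open>Orthogonality\<close>

text \<open>Translation by a vector that pairs to \<open>a\<close> with \<open>v\<close> shows that all level sets of the pairing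
  with \<open>v\<close> have the same size.\<close>

lemma card_orthogonal:
  fixes v :: "'f::{field, finite} ^ 'm::finite"
  assumes "v \<noteq> 0"
  shows "CARD('f) * card {w. pairing v w = 0} = CARD('f) ^ CARD('m)"
proof -
  obtain u where u: "pairing v u = 1" using assms by (rule ex_pairing_eq_1)
  have level: "card {w. pairing v w = a} = card {w. pairing v w = 0}" for a
  proof (rule bij_betw_same_card)
    show "bij_betw (\<lambda>w. w - a *s u) {w. pairing v w = a} {w. pairing v w = 0}"
      using u by (intro bij_betwI[where g = "\<lambda>w. w + a *s u"])
        (auto simp: pairing_diff pairing_add pairing_scale)
  qed
  have "CARD('f ^ 'm) = (\<Sum>a\<in>UNIV. card {w. pairing v w = a})"
    using sum.group[of UNIV UNIV "pairing v" "\<lambda>_. 1::nat"] by simp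
  also have "\<dots> = (\<Sum>a::'f\<in>UNIV. card {w. pairing v w = 0})"
    by (intro sum.cong refl level)
  finally show ?thesis by simp
qed

lemma card_nonorthogonal:
  fixes v :: "'f::{field, finite} ^ 'm::finite"
  assumes "v \<noteq> 0" "CARD('m) = d + 1"
  shows "card {w. pairing v w \<noteq> 0} = (CARD('f) - 1) * CARD('f) ^ d"
proof -
  have "card {w. pairing v w = 0} = CARD('f) ^ d"
    using card_orthogonal[OF assms(1)] assms(2) by simp
  moreover have "card {w. pairing v w \<noteq> 0} = CARD('f ^ 'm) - card {w. pairing v w = 0}"
    by (subst card_Diff_subset[symmetric]) (auto intro!: arg_cong[where f = card])
  ultimately show ?thesis
    using assms(2) by (simp add: diff_mult_distrib)
qed

context nontrivial_character
begin

text \<open>Let \<open>u\<close> pair to \<open>1\<close> with \<open>v\<close> and to \<open>0\<close> with \<open>v'\<close>, and let \<open>c\<close> be a nonzero scalar at which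
  the character is not \<open>1\<close>. The substitution \<open>w \<mapsto> w + (c - 1) \<langle>v, w\<rangle> u\<close> multiplies \<open>\<langle>v, w\<rangle>\<close> by
  \<open>c\<close> and preserves \<open>\<langle>v', w\<rangle>\<close>. Hence it multiplies the sum by the value at \<open>c\<close>, and the sum is zero.\<close>

lemma character_sum_eq_0:
  fixes v v' :: "'f ^ 'm::finite"
  assumes "v \<noteq> 0" "\<And>c. v' \<noteq> c *s v"
  shows "(\<Sum>w\<in>UNIV. \<psi> (pairing v w) * cnj (\<psi> (pairing v' w))) = 0" (is "?S = 0")
proof -
  obtain u where u: "pairing v u = 1" "pairing v' u = 0"
    using assms by (rule ex_pairing_eq_1_0)
  obtain c where c: "c \<noteq> 0" "\<psi> c \<noteq> 1" using nontrivial by blast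
  define T where "T k w = w + ((k - 1) * pairing v w) *s u" for k and w :: "'f ^ 'm"
  have T: "pairing v (T k w) = k * pairing v w" "pairing v' (T k w) = pairing v' w" for k w
    using u by (simp_all add: T_def pairing_add pairing_diff pairing_scale left_diff_distrib)
  have T_inv: "T k (T l w) = w" if "k * l = 1" for k l w
  proof -
    have "T k (T l w) = w + ((l - 1) * pairing v w + (k - 1) * (l * pairing v w)) *s u"
      unfolding T_def[of k] T(1) by (simp add: T_def vec.scale_left_distrib)
    also have "(l - 1) * pairing v w + (k - 1) * (l * pairing v w) = (k * l - 1) * pairing v w"
      by (simp add: algebra_simps)
    finally show ?thesis using that by simp
  qed
  have "bij (T c)"
    using c(1) by (intro o_bij[where g = "T (1 / c)"]) (auto simp: fun_eq_iff T_inv)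
  then have "?S = (\<Sum>w\<in>UNIV. \<psi> (pairing v (T c w)) * cnj (\<psi> (pairing v' (T c w))))"
    by (rule sum.reindex_bij_betw[symmetric])
  also have "\<dots> = \<psi> c * ?S"
    by (simp add: T char_mult sum_distrib_left mult.assoc)
  finally show "?S = 0" using c(2) by simp
qed

definition weighing_matrix :: "complex ^ ('f, 'm::finite) proj ^ ('f, 'm) proj"
  where "weighing_matrix = (\<chi> x y. \<psi> (pairing (rep x) (rep y)))"

lemma weighing_matrix_orthogonality:
  assumes "CARD('m::finite) = d + 1"
  shows "weighing_matrix ** ctranspose weighing_matrix =
    (mat (of_nat (CARD('f) ^ d)) :: complex ^ ('f, 'm) proj ^ ('f, 'm) proj)"
proof -
  have q: "CARD('f) > 1"
    using card_mono[of UNIV "{0, 1 :: 'f}"] by simp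
  have "(weighing_matrix ** ctranspose weighing_matrix) $ x $ x' =
      (if x = x' then of_nat (CARD('f) ^ d) else 0)" for x x' :: "('f, 'm) proj"
  proof -
    define f where "f w = \<psi> (pairing (rep x) w) * cnj (\<psi> (pairing (rep x') w))" for w
    let ?S = "\<Sum>w\<in>UNIV. f w"
    have "f (c *s w) = f w" if "c \<noteq> 0" for c w
    proof -
      have "f (c *s w) = (\<psi> c * cnj (\<psi> c)) * f w"
        by (simp add: f_def pairing_scale char_mult)
      then show ?thesis by (simp add: char_mult_cnj[OF that])
    qed
    then have "?S = of_nat (CARD('f) - 1) * (\<Sum>y\<in>UNIV. f (rep y))"
      by (intro sum_vectors_eq_sum_points) (simp_all add: f_def)
    then have entry: "of_nat (CARD('f) - 1) * (weighing_matrix ** ctranspose weighing_matrix) $ x $ x'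
        = ?S"
      by (simp add: matrix_matrix_mult_def ctranspose_def weighing_matrix_def f_def)
    have S: "?S = of_nat (CARD('f) - 1) * (if x = x' then of_nat (CARD('f) ^ d) else 0)"
    proof (cases "x = x'")
      case True
      have "?S = (\<Sum>w\<in>UNIV. if pairing (rep x) w \<noteq> 0 then 1 else 0)"
        using True by (intro sum.cong) (auto simp: f_def char_mult_cnj)
      also have "\<dots> = of_nat (card {w. pairing (rep x) w \<noteq> 0})"
        by (simp add: sum.If_cases)
      finally show ?thesis
        using True by (simp add: card_nonorthogonal[OF rep_nonzero assms])
    next
      case False
      have "rep x' \<noteq> c *s rep x" for c
        using False proj_point_eq_iff[of "rep x" "rep x'"] by (cases "c = 0") auto
      then show ?thesis
        using False character_sum_eq_0[of "rep x" "rep x'"] by (simp add: f_def)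
    qed
    show ?thesis
      using entry unfolding S by (rule mult_left_cancel[THEN iffD1, rotated]) (use q in simp)
  qed
  then show ?thesis
    by (simp add: vec_eq_iff mat_def)
qed

lemma weighing_matrix_in_GW:
  assumes "CARD('m::finite) = d + 1"
  shows "(weighing_matrix :: complex ^ ('f, 'm) proj ^ ('f, 'm) proj) \<in>
    GW ((CARD('f) ^ (d + 1) - 1) div (CARD('f) - 1)) (CARD('f) ^ d) n"
proof -
  have "CARD('f) > 1"
    using card_mono[of UNIV "{0, 1 :: 'f}"] by simp
  then have "CARD(('f, 'm) proj) = (CARD('f) ^ (d + 1) - 1) div (CARD('f) - 1)"
    using card_proj[where 'f = 'f and 'm = 'm] unfolding assms
    by (metis nonzero_mult_div_cancel_left less_numeral_extra(3) zero_less_diff)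
  moreover have "\<psi> a \<in> roots_of_unity0 n" for a
    by (cases "a = 0") (simp_all add: roots_of_unity0_def roots_of_unity_def char_pow)
  ultimately show ?thesis
    using weighing_matrix_orthogonality[OF assms] by (simp add: GW_def weighing_matrix_def)
qed

lemma abs_weighing_matrix:
  "abs_matrix (weighing_matrix :: complex ^ ('f, 'm::finite) proj ^ ('f, 'm) proj) =
    char_matrix nonincident"
proof -
  have "(x, y) \<in> nonincident \<longleftrightarrow> pairing (rep x) (rep y) \<noteq> 0"
    for x y :: "('f, 'm) proj"
    using nonincident_iff_pairing[of "rep x" "rep y"] by simp
  then show ?thesis
    by (simp add: vec_eq_iff abs_matrix_def char_matrix_def weighing_matrix_def norm_char)
qed

end

section \<open>Weighted permutation matrices\<close>

definition weighted_perm_matrix :: "('i \<Rightarrow> 'i) \<Rightarrow> ('i \<Rightarrow> complex) \<Rightarrow> complex ^ 'i ^ 'i"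
  where "weighted_perm_matrix f c = (\<chi> j i. if j = f i then c i else 0)"

lemma matrix_of_map_eq_weighted: "matrix_of_map f = weighted_perm_matrix f (\<lambda>_. 1)"
  by (simp add: matrix_of_map_def weighted_perm_matrix_def)

lemma monomial_weighted_perm_matrix:
  assumes "bij f" "\<And>i. c i \<noteq> 0"
  shows "monomial_matrix (weighted_perm_matrix f c)"
proof -
  have "\<exists>!i. j = f i" for j
    using assms(1) by (metis bij_pointE)
  then show ?thesis
    using assms(2) by (auto simp: monomial_matrix_def weighted_perm_matrix_def)
qed

lemma abs_weighted_perm_matrix:
  assumes "\<And>i. norm (c i) = 1"
  shows "abs_matrix (weighted_perm_matrix f c) = matrix_of_map f"
  by (simp add: vec_eq_iff abs_matrix_def weighted_perm_matrix_def matrix_of_map_def assms)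

text \<open>Conjugation by weighted permutation matrices moves the entry at \<open>(x, y)\<close> to \<open>(f x, h y)\<close>
  and multiplies it by the two weights.\<close>

lemma weighted_perm_matrix_conjugation:
  fixes B :: "complex ^ 'c::finite ^ 'r::finite"
  assumes "bij f" "bij h"
  shows "(weighted_perm_matrix f c ** B ** ctranspose (weighted_perm_matrix h e)) $ f x $ h y =
    c x * B $ x $ y * cnj (e y)"
proof -
  have f: "f x = f k \<longleftrightarrow> k = x" and h: "h y = h l \<longleftrightarrow> l = y" for k l
    using assms by (auto simp: bij_def inj_eq)
  have "(weighted_perm_matrix f c ** B) $ f x $ l =
      (\<Sum>k\<in>UNIV. if k = x then c k * B $ k $ l else 0)" for l
    by (simp only: matrix_matrix_mult_def weighted_perm_matrix_def vec_lambda_beta f)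
      (intro sum.cong, auto)
  then have row: "(weighted_perm_matrix f c ** B) $ f x $ l = c x * B $ x $ l" for l
    by simp
  have "(weighted_perm_matrix f c ** B ** ctranspose (weighted_perm_matrix h e)) $ f x $ h y =
      (\<Sum>l\<in>UNIV. c x * B $ x $ l * ctranspose (weighted_perm_matrix h e) $ l $ h y)"
    by (subst matrix_matrix_mult_def) (simp add: row)
  also have "\<dots> = (\<Sum>l\<in>UNIV. if l = y then c x * B $ x $ l * cnj (e l) else 0)"
    by (intro sum.cong) (simp_all add: ctranspose_def weighted_perm_matrix_def h)
  finally show ?thesis by simp
qed

lemma weighted_perm_matrix_fixes:
  fixes B :: "complex ^ 'c::finite ^ 'r::finite"
  assumes "bij f" "bij h" and eq: "\<And>x y. B $ f x $ h y = c x * B $ x $ y * cnj (e y)"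
  shows "weighted_perm_matrix f c ** B ** ctranspose (weighted_perm_matrix h e) = B" (is "?M = B")
proof -
  have "?M $ i $ j = B $ i $ j" for i j
  proof -
    obtain x y where "i = f x" "j = h y"
      using assms(1,2) by (meson bij_pointE)
    then show ?thesis
      by (simp add: weighted_perm_matrix_conjugation[OF assms(1,2)] eq)
  qed
  then show ?thesis by (simp add: vec_eq_iff)
qed

section \<open>Lifting the action\<close>

lemma GL_perm_in_PermAut:
  fixes g :: "'f::{field, finite} ^ 'm::finite ^ 'm"
  assumes g: "invertible g"
  shows "GL_perm g \<in> PermAut (char_matrix nonincident)"
proof -
  have "matrix_of_map (act_X g) ** char_matrix nonincident ** ctranspose (matrix_of_map (act_Y g))
      = char_matrix nonincident"
    unfolding matrix_of_map_eq_weighted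
    by (rule weighted_perm_matrix_fixes[OF bij_act_X[OF g] bij_act_Y[OF g]])
      (simp add: char_matrix_def nonincident_act_iff[OF g])
  then show ?thesis
    using bij_act_X[OF g] bij_act_Y[OF g]
    by (auto simp: PermAut_def GL_perm_def permutation_matrix_def)
qed

context nontrivial_character
begin

text \<open>The chosen representatives are not permuted by \<open>g\<close>: they are permuted up to scalars \<open>\<alpha> x\<close> and
  \<open>\<beta> y\<close>. As the pairing is invariant, the entries of the matrix change by the values of the character
  at these scalars, and these values are the weights of the lift.\<close>

lemma weighing_matrix_lifts_GL:
  fixes g :: "'f ^ 'm::finite ^ 'm"
  assumes g: "invertible g"
  shows "lifts_to_Aut n weighing_matrix (GL_perm g)"
proof -
  have "\<exists>c. c \<noteq> 0 \<and> rep (act_X g x) = c *s (g *v rep x)" for x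
    using rep_proj_point[OF invertible_vector_mult_nonzero[OF g rep_nonzero, of x]]
      act_X_proj_point[OF rep_nonzero, of g x] by (metis proj_point_rep)
  then obtain \<alpha> where \<alpha>: "\<And>x. \<alpha> x \<noteq> 0" "\<And>x. rep (act_X g x) = \<alpha> x *s (g *v rep x)"
    by metis
  have "\<exists>c. c \<noteq> 0 \<and> rep (act_Y g y) = c *s (contragredient g *v rep y)" for y
    using rep_proj_point[OF contragredient_vector_mult_nonzero[OF g rep_nonzero, of y]]
      act_Y_contragredient[OF rep_nonzero, of g y] by (metis proj_point_rep)
  then obtain \<beta> where \<beta>: "\<And>y. \<beta> y \<noteq> 0" "\<And>y. rep (act_Y g y) = \<beta> y *s (contragredient g *v rep y)"
    by metis
  define P where "P = weighted_perm_matrix (act_X g) (\<lambda>x. \<psi> (\<alpha> x))"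
  define Q where "Q = weighted_perm_matrix (act_Y g) (\<lambda>y. cnj (\<psi> (\<beta> y)))"
  have nz: "\<psi> (\<alpha> x) \<noteq> 0" "\<psi> (\<beta> y) \<noteq> 0" for x y
    using norm_char[OF \<alpha>(1)[of x]] norm_char[OF \<beta>(1)[of y]] by auto
  have "P ** weighing_matrix ** ctranspose Q = weighing_matrix"
    unfolding P_def Q_def
  proof (rule weighted_perm_matrix_fixes[OF bij_act_X[OF g] bij_act_Y[OF g]])
    fix x y
    show "weighing_matrix $ act_X g x $ act_Y g y =
        \<psi> (\<alpha> x) * weighing_matrix $ x $ y * cnj (cnj (\<psi> (\<beta> y)))"
      by (simp add: weighing_matrix_def \<alpha>(2) \<beta>(2) pairing_scale pairing_contragredient[OF g]
          char_mult)
  qed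
  moreover have "monomial_matrix P" "monomial_matrix Q"
    unfolding P_def Q_def
    by (rule monomial_weighted_perm_matrix[OF bij_act_X[OF g]], simp add: nz)
      (rule monomial_weighted_perm_matrix[OF bij_act_Y[OF g]], simp add: nz)
  moreover have "P $ i $ j \<noteq> 0 \<longrightarrow> P $ i $ j \<in> roots_of_unity n"
    "Q $ i $ j \<noteq> 0 \<longrightarrow> Q $ i $ j \<in> roots_of_unity n" for i j
    by (auto simp: P_def Q_def weighted_perm_matrix_def roots_of_unity_def char_pow \<alpha>(1) \<beta>(1)
        simp flip: complex_cnj_power)
  ultimately have "(P, Q) \<in> Aut n weighing_matrix"
    by (simp add: Aut_def)
  moreover have "(abs_matrix P, abs_matrix Q) = GL_perm g"
    by (simp add: P_def Q_def GL_perm_def abs_weighted_perm_matrix norm_char \<alpha>(1) \<beta>(1))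
  ultimately show ?thesis
    unfolding lifts_to_Aut_def by blast
qed

end

theorem theorem6p1:
  fixes q d n :: nat
  assumes "primepow q"
    and "CARD('f::{field, finite}) = q"
    and "d > 0"
    and "CARD('m::finite) = d + 1"
    and "n > 1"
    and "n dvd q - 1"
  shows "\<exists>A :: complex ^ ('f, 'm) proj ^ ('f, 'm) proj.
      A \<in> GW ((q ^ (d + 1) - 1) div (q - 1)) (q ^ d) n \<and>
      (nonincident :: (('f, 'm) proj \<times> ('f, 'm) proj) set) \<in> range GL_orbit \<and>
      abs_matrix A = char_matrix nonincident \<and>
      (\<forall>PQ \<in> GL_perm ` (GL :: ('f ^ 'm ^ 'm) set).
        PQ \<in> PermAut (abs_matrix A) \<and> lifts_to_Aut n A PQ)"
proof -
  obtain \<psi> :: "'f \<Rightarrow> complex" where "nontrivial_character \<psi> n"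
    using ex_nontrivial_character[of n, where 'f = 'f] assms by auto
  then interpret nontrivial_character \<psi> n .
  show ?thesis
    using weighing_matrix_in_GW[OF assms(4)] assms(2)
    by (intro exI[of _ weighing_matrix])
      (auto simp: nonincident_is_GL_orbit abs_weighing_matrix GL_def
        intro: GL_perm_in_PermAut weighing_matrix_lifts_GL)
qed

end
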